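(* For every sup-lattice $S$ there exists a Girard quantale $\mathcal{G}(S)$ such that $\mathcal{R}(\mathcal{G}(S))\cong S$ and $\mathcal{L}(\mathcal{G}(S))\cong S^{\mathrm{op}}$ as sup-lattices.
   Context: A sup-lattice is a complete lattice, with top $1$ and bottom $0$; morphisms (sup-homomorphisms) preserve arbitrary suprema. $S^{\mathrm{op}}$ is the opposite lattice. A quantale $Q$ is a sup-lattice with an associative multiplication distributing over arbitrary joins in each variable. For $a,b\in Q$, $b\leftarrow a=\bigvee\{c\in Q\mid ac\le b\}$ and $a\rightarrow b=\bigvee\{c\in Q\mid ca\le b\}$. An element $d\in Q$ is cyclic if $ab\le d\iff ba\le d$ for all $a,b\in Q$, and dualizing if $d\leftarrow(a\rightarrow d)=(d\leftarrow a)\rightarrow d=a$ for all $a\in Q$. $Q$ is a Girard quantale if it has a cyclic dualizing element. $\mathcal{R}(Q)=\{r\in Q\mid r1\le r\}$ and $\mathcal{L}(Q)=\{l\in Q\mid 1l\le l\}$ are the sup-lattices of right-sided and left-sided elements. *)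

theory Defs
  imports "HOL-Algebra.Complete_Lattice"
begin

text \<open>
  Sup-lattices are the complete lattices of HOL-Algebra (with carrier set; the empty family is
  included, so the carrier is nonempty).  The opposite of \<open>S\<close> is \<open>inv_gorder S\<close>, and
  \<open>sup_pres\<close> is preservation of arbitrary suprema, including the empty one.
\<close>

record 'a quantale = "'a gorder" +
  qmult :: "'a \<Rightarrow> 'a \<Rightarrow> 'a"  (infixl \<open>\<odot>\<index>\<close> 70)

locale quantale = complete_lattice Q for Q (structure) +
  assumes qmult_closed:
      "\<lbrakk>a \<in> carrier Q; b \<in> carrier Q\<rbrakk> \<Longrightarrow> a \<odot> b \<in> carrier Q"
    and qmult_assoc:
      "\<lbrakk>a \<in> carrier Q; b \<in> carrier Q; c \<in> carrier Q\<rbrakk> \<Longrightarrow> (a \<odot> b) \<odot> c = a \<odot> (b \<odot> c)"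
    and qmult_sup_right:
      "\<lbrakk>a \<in> carrier Q; B \<subseteq> carrier Q\<rbrakk> \<Longrightarrow> a \<odot> (\<Squnion>B) = \<Squnion>((\<lambda>b. a \<odot> b) ` B)"
    and qmult_sup_left:
      "\<lbrakk>A \<subseteq> carrier Q; b \<in> carrier Q\<rbrakk> \<Longrightarrow> (\<Squnion>A) \<odot> b = \<Squnion>((\<lambda>a. a \<odot> b) ` A)"

text \<open>
  \<open>res_left Q b a\<close> is $b \leftarrow a$ and \<open>res_right Q a b\<close> is $a \rightarrow b$; the side on
  which \<open>a\<close> is multiplied follows the convention $ac \le b \iff c \le b \leftarrow a$ and
  $ca \le b \iff c \le a \rightarrow b$.
\<close>

definition res_left :: "('a, 'm) quantale_scheme \<Rightarrow> 'a \<Rightarrow> 'a \<Rightarrow> 'a" where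
  "res_left Q b a = \<Squnion>\<^bsub>Q\<^esub> {c \<in> carrier Q. a \<odot>\<^bsub>Q\<^esub> c \<sqsubseteq>\<^bsub>Q\<^esub> b}"

definition res_right :: "('a, 'm) quantale_scheme \<Rightarrow> 'a \<Rightarrow> 'a \<Rightarrow> 'a" where
  "res_right Q a b = \<Squnion>\<^bsub>Q\<^esub> {c \<in> carrier Q. c \<odot>\<^bsub>Q\<^esub> a \<sqsubseteq>\<^bsub>Q\<^esub> b}"

definition cyclic :: "('a, 'm) quantale_scheme \<Rightarrow> 'a \<Rightarrow> bool" where
  "cyclic Q d \<longleftrightarrow>
     (\<forall>a\<in>carrier Q. \<forall>b\<in>carrier Q. a \<odot>\<^bsub>Q\<^esub> b \<sqsubseteq>\<^bsub>Q\<^esub> d \<longleftrightarrow> b \<odot>\<^bsub>Q\<^esub> a \<sqsubseteq>\<^bsub>Q\<^esub> d)"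

definition dualizing :: "('a, 'm) quantale_scheme \<Rightarrow> 'a \<Rightarrow> bool" where
  "dualizing Q d \<longleftrightarrow>
     (\<forall>a\<in>carrier Q. res_left Q d (res_right Q a d) = a \<and> res_right Q (res_left Q d a) d = a)"

locale girard_quantale = quantale +
  assumes cyclic_dualizing_exists: "\<exists>d\<in>carrier Q. cyclic Q d \<and> dualizing Q d"

definition right_sided :: "('a, 'm) quantale_scheme \<Rightarrow> 'a gorder" where
  "right_sided Q =
     \<lparr> carrier = {r \<in> carrier Q. r \<odot>\<^bsub>Q\<^esub> \<top>\<^bsub>Q\<^esub> \<sqsubseteq>\<^bsub>Q\<^esub> r}, eq = (.=\<^bsub>Q\<^esub>), le = (\<sqsubseteq>\<^bsub>Q\<^esub>) \<rparr>"

definition left_sided :: "('a, 'm) quantale_scheme \<Rightarrow> 'a gorder" where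
  "left_sided Q =
     \<lparr> carrier = {l \<in> carrier Q. \<top>\<^bsub>Q\<^esub> \<odot>\<^bsub>Q\<^esub> l \<sqsubseteq>\<^bsub>Q\<^esub> l}, eq = (.=\<^bsub>Q\<^esub>), le = (\<sqsubseteq>\<^bsub>Q\<^esub>) \<rparr>"

text \<open>
  The inverse of a bijective sup-homomorphism is again a sup-homomorphism, so bijective
  sup-homomorphisms are the isomorphisms.  Note that \<open>sup_pres\<close> also asserts that both
  sides are complete lattices.
\<close>

definition sup_lattice_iso :: "('a, 'm) gorder_scheme \<Rightarrow> ('b, 'n) gorder_scheme \<Rightarrow> bool" where
  "sup_lattice_iso L M \<longleftrightarrow> (\<exists>h. bij_betw h (carrier L) (carrier M) \<and> sup_pres L M h)"

text \<open>
  HOL cannot quantify existentially over types, so an existence statement about quantales must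
  name the type containing the carrier.  For a sup-lattice in \<open>'a\<close> we use the type below,
  which has room for pairs of an endomap of \<open>S\<close> and an element of the tensor product
  $S \otimes S^{\mathrm{op}}$ (a subset of $S \times S$).  The carrier itself remains
  an arbitrary subset of this type.
\<close>

type_synonym 'a girard_elem = "('a \<Rightarrow> 'a) \<times> ('a \<times> 'a) set"

end

theory Submission
  imports Defs
begin

text \<open>
  Let \<open>Q\<close> be the quantale of sup-endomorphisms of \<open>S\<close>.  The Girard quantale consists of the pairs
  \<open>(q, p)\<close> in \<open>Q \<times> Q\<close>, ordered by \<open>\<le>\<close> in the first and \<open>\<ge>\<close> in the second component, such that
  \<open>s \<le> p x\<close> or \<open>x \<le> q s\<close> for all \<open>x\<close> and \<open>s\<close>.  The duality is the swap \<open>(q, p)\<^sup>\<bottom> = (p, q)\<close>, and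
  the multiplication is determined by
  \[ xy \le z^\perp \iff q_x q_y \le p_z,\; q_y q_z \le p_x,\; q_z q_x \le p_y , \]
  a condition that is visibly invariant under cyclic permutation.  (The second component stands for
  an element of $S \otimes S^{\mathrm{op}} \cong Q^{\mathrm{op}}$; the side condition says that
  the image of this element under the canonical map $S \otimes S^{\mathrm{op}} \to Q$ lies
  below \<open>q\<close>.)  In a right-sided element \<open>q\<close> is constantly \<open>a\<close> off the bottom, and \<open>p\<close> takes only
  the values bottom and top; the side condition then forces \<open>p\<close> to vanish exactly below \<open>a\<close>.
  Hence the right-sided elements correspond to the elements \<open>a\<close> of \<open>S\<close>, and the duality
  exchanges right-sided and left-sided elements.
\<close>

section \<open>Isomorphisms and Girard duality\<close>

lemma (in complete_lattice) dual_complete_lattice: "complete_lattice (inv_gorder L)"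
proof -
  interpret dual: partial_order "inv_gorder L"
    by (rule dual_order)
  show ?thesis
    by unfold_locales (simp_all add: inf_exists sup_exists)
qed

lemma (in complete_lattice) sup_eqI:
  assumes "A \<subseteq> carrier L" "s \<in> carrier L"
    and "\<And>z. z \<in> carrier L \<Longrightarrow> s \<sqsubseteq> z \<longleftrightarrow> (\<forall>a\<in>A. a \<sqsubseteq> z)"
  shows "\<Squnion>A = s"
proof (rule le_antisym)
  show "\<Squnion>A \<sqsubseteq> s"
    using assms(3)[OF assms(2)] assms(1,2) by (intro sup_least) auto
  show "s \<sqsubseteq> \<Squnion>A"
    using assms by (auto intro: sup_upper)
qed (use assms in auto)

lemma (in complete_lattice) sup_le_iff:
  assumes "A \<subseteq> carrier L" "z \<in> carrier L"
  shows "\<Squnion>A \<sqsubseteq> z \<longleftrightarrow> (\<forall>a\<in>A. a \<sqsubseteq> z)"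
proof
  assume le: "\<Squnion>A \<sqsubseteq> z"
  show "\<forall>a\<in>A. a \<sqsubseteq> z"
  proof
    fix a assume "a \<in> A"
    then show "a \<sqsubseteq> z"
      using assms le by (intro le_trans[OF sup_upper[of A a] le]) auto
  qed
qed (use assms in \<open>auto intro: sup_least\<close>)

text \<open>Infima come for free: the infimum of \<open>A\<close> is the supremum of its set of
  lower bounds.\<close>

lemma (in partial_order) complete_lattice_supI:
  assumes sup: "\<And>A. A \<subseteq> carrier L \<Longrightarrow>
    \<exists>s\<in>carrier L. (\<forall>a\<in>A. a \<sqsubseteq> s) \<and> (\<forall>z\<in>carrier L. (\<forall>a\<in>A. a \<sqsubseteq> z) \<longrightarrow> s \<sqsubseteq> z)"
  shows "complete_lattice L"
proof unfold_locales
  fix A assume A: "A \<subseteq> carrier L"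
  obtain s where s: "s \<in> carrier L"
    "(\<forall>a\<in>A. a \<sqsubseteq> s) \<and> (\<forall>z\<in>carrier L. (\<forall>a\<in>A. a \<sqsubseteq> z) \<longrightarrow> s \<sqsubseteq> z)"
    by (rule bexE[OF sup[OF A]])
  have "z \<in> Upper L A \<longleftrightarrow> z \<in> carrier L \<and> (\<forall>a\<in>A. a \<sqsubseteq> z)" for z
    using A by (auto simp: Upper_def)
  with s have "least L s (Upper L A)"
    by (simp add: least_def)
  then show "\<exists>s. least L s (Upper L A)" ..
  obtain i where i: "i \<in> carrier L"
    "(\<forall>a\<in>Lower L A. a \<sqsubseteq> i) \<and> (\<forall>z\<in>carrier L. (\<forall>a\<in>Lower L A. a \<sqsubseteq> z) \<longrightarrow> i \<sqsubseteq> z)"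
    by (rule bexE[OF sup[OF Lower_closed]])
  moreover have "\<forall>a\<in>Lower L A. a \<sqsubseteq> x" if "x \<in> A" for x
    using A that by (auto simp: Lower_def)
  ultimately have "greatest L i (Lower L A)"
    using A by (auto simp: greatest_def intro!: Lower_memI)
  then show "\<exists>i. greatest L i (Lower L A)" ..
qed

text \<open>Suprema are determined by the order, so an order isomorphism onto \<open>M\<close>
  transports completeness back to \<open>K\<close> and preserves suprema. This also yields
  completeness of the one-sided elements.\<close>

lemma sup_lattice_isoI:
  assumes M: "complete_lattice M"
    and bij: "bij_betw h (carrier K) (carrier M)"
    and le: "\<And>x y. \<lbrakk>x \<in> carrier K; y \<in> carrier K\<rbrakk> \<Longrightarrow> x \<sqsubseteq>\<^bsub>K\<^esub> y \<longleftrightarrow> h x \<sqsubseteq>\<^bsub>M\<^esub> h y"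
    and eq: "(.=\<^bsub>K\<^esub>) = (=)"
  shows "sup_lattice_iso K M"
proof -
  interpret M: complete_lattice M by (rule M)
  have hc: "h x \<in> carrier M" if "x \<in> carrier K" for x
    using bij that by (auto simp: bij_betw_def)
  have inj: "x = y" if "x \<in> carrier K" "y \<in> carrier K" "h x = h y" for x y
    using bij that by (auto simp: bij_betw_def inj_on_def)
  have surj: "\<exists>x\<in>carrier K. h x = y" if "y \<in> carrier M" for y
    using bij that by (metis bij_betw_imp_surj_on imageE)
  interpret K: partial_order K
  proof (unfold_locales, goal_cases)
    case (5 x y)
    then show ?case using le hc inj M.le_antisym eq by metis
  next
    case (6 x y z)
    then show ?case using le hc M.le_trans by metis
  qed (use le hc eq in auto)
  have "complete_lattice K"
  proof (rule K.complete_lattice_supI)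
    fix A assume A: "A \<subseteq> carrier K"
    then have hA: "h ` A \<subseteq> carrier M" using hc by auto
    obtain s where s: "s \<in> carrier K" "h s = \<Squnion>\<^bsub>M\<^esub>(h ` A)"
      using surj[OF M.sup_closed[OF hA]] by auto
    have "s \<sqsubseteq>\<^bsub>K\<^esub> z \<longleftrightarrow> (\<forall>a\<in>A. a \<sqsubseteq>\<^bsub>K\<^esub> z)" if z: "z \<in> carrier K" for z
      using le[OF s(1) z] M.sup_le_iff[OF hA hc[OF z]] s(2) le[OF _ z] A
      by (simp add: subset_iff)
    moreover have "\<forall>a\<in>A. a \<sqsubseteq>\<^bsub>K\<^esub> s"
      using calculation[OF s(1)] K.le_refl[OF s(1)] by blast
    ultimately show "\<exists>s\<in>carrier K. (\<forall>a\<in>A. a \<sqsubseteq>\<^bsub>K\<^esub> s) \<and>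
        (\<forall>z\<in>carrier K. (\<forall>a\<in>A. a \<sqsubseteq>\<^bsub>K\<^esub> z) \<longrightarrow> s \<sqsubseteq>\<^bsub>K\<^esub> z)"
      using s(1) by (intro bexI[of _ s]) simp_all
  qed
  then interpret K: complete_lattice K .
  have "h (\<Squnion>\<^bsub>K\<^esub>A) = \<Squnion>\<^bsub>M\<^esub>(h ` A)" if A: "A \<subseteq> carrier K" for A
  proof (rule M.sup_eqI[symmetric])
    show "h ` A \<subseteq> carrier M" "h (\<Squnion>\<^bsub>K\<^esub>A) \<in> carrier M"
      using A hc by auto
    fix z assume "z \<in> carrier M"
    then obtain w where w: "w \<in> carrier K" "z = h w" using surj by blast
    show "h (\<Squnion>\<^bsub>K\<^esub>A) \<sqsubseteq>\<^bsub>M\<^esub> z \<longleftrightarrow> (\<forall>a\<in>h ` A. a \<sqsubseteq>\<^bsub>M\<^esub> z)"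
      using K.sup_le_iff[OF A w(1)] le[OF _ w(1)] le[OF K.sup_closed[OF A] w(1)] w(2) A
      by (simp add: subset_iff)
  qed
  then show ?thesis
    using bij M K.complete_lattice_axioms by (auto simp: sup_lattice_iso_def sup_pres_def)
qed

text \<open>The cyclic law and the antitone involution \<open>n\<close> provide both residuals,
  \<open>n (n z \<odot> x)\<close> and \<open>n (y \<odot> n z)\<close>. Multiplication thus has
  right adjoints in each variable, which gives distributivity over joins without computing any
  join.\<close>

lemma girard_quantaleI:
  fixes G (structure)
  assumes "complete_lattice G"
    and perp: "\<And>x. x \<in> carrier G \<Longrightarrow> n x \<in> carrier G"
      "\<And>x. x \<in> carrier G \<Longrightarrow> n (n x) = x"
      "\<And>x y. \<lbrakk>x \<in> carrier G; y \<in> carrier G\<rbrakk> \<Longrightarrow> n x \<sqsubseteq> n y \<longleftrightarrow> y \<sqsubseteq> x"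
    and mult: "\<And>x y. \<lbrakk>x \<in> carrier G; y \<in> carrier G\<rbrakk> \<Longrightarrow> x \<odot> y \<in> carrier G"
      "\<And>x y z. \<lbrakk>x \<in> carrier G; y \<in> carrier G; z \<in> carrier G\<rbrakk> \<Longrightarrow> (x \<odot> y) \<odot> z = x \<odot> (y \<odot> z)"
    and cyc: "\<And>x y z. \<lbrakk>x \<in> carrier G; y \<in> carrier G; z \<in> carrier G\<rbrakk> \<Longrightarrow>
      x \<odot> y \<sqsubseteq> n z \<longleftrightarrow> y \<odot> z \<sqsubseteq> n x"
    and d: "d \<in> carrier G"
      "\<And>x y. \<lbrakk>x \<in> carrier G; y \<in> carrier G\<rbrakk> \<Longrightarrow> x \<odot> y \<sqsubseteq> d \<longleftrightarrow> x \<sqsubseteq> n y"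
  shows "girard_quantale G"
proof -
  interpret complete_lattice G by fact
  have perp_sym: "x \<sqsubseteq> n y \<longleftrightarrow> y \<sqsubseteq> n x" if "x \<in> carrier G" "y \<in> carrier G" for x y
    using perp that by metis
  have right: "x \<odot> y \<sqsubseteq> z \<longleftrightarrow> y \<sqsubseteq> n (n z \<odot> x)"
    and left: "x \<odot> y \<sqsubseteq> z \<longleftrightarrow> x \<sqsubseteq> n (y \<odot> n z)"
    if "x \<in> carrier G" "y \<in> carrier G" "z \<in> carrier G" for x y z
  proof -
    have nz: "n z \<in> carrier G" "n (n z) = z" using that perp by simp_all
    have 1: "x \<odot> y \<sqsubseteq> z \<longleftrightarrow> y \<odot> n z \<sqsubseteq> n x"
      using cyc[of x y "n z"] that nz by simp
    also have "\<dots> \<longleftrightarrow> n z \<odot> x \<sqsubseteq> n y"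
      using cyc[of y "n z" x] that nz by simp
    also have "\<dots> \<longleftrightarrow> y \<sqsubseteq> n (n z \<odot> x)"
      using that nz mult by (intro perp_sym) auto
    finally show "x \<odot> y \<sqsubseteq> z \<longleftrightarrow> y \<sqsubseteq> n (n z \<odot> x)" .
    show "x \<odot> y \<sqsubseteq> z \<longleftrightarrow> x \<sqsubseteq> n (y \<odot> n z)"
      unfolding 1 using that nz mult by (intro perp_sym) auto
  qed
  show ?thesis
  proof (unfold_locales, goal_cases)
    case (1 x y)
    then show ?case by (rule mult(1))
  next
    case (2 x y z)
    then show ?case by (rule mult(2))
  next
    case (3 x B)
    show ?case
    proof (rule sup_eqI[symmetric])
      fix z assume z: "z \<in> carrier G"
      have "n (n z \<odot> x) \<in> carrier G" using 3 z perp mult by simp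
      then show "x \<odot> \<Squnion>B \<sqsubseteq> z \<longleftrightarrow> (\<forall>b\<in>(\<odot>) x ` B. b \<sqsubseteq> z)"
        using 3 z right[of x _ z] by (auto simp: sup_le_iff subset_iff)
    qed (use 3 mult in auto)
  next
    case (4 A y)
    show ?case
    proof (rule sup_eqI[symmetric])
      fix z assume z: "z \<in> carrier G"
      have "n (y \<odot> n z) \<in> carrier G" using 4 z perp mult by simp
      then show "\<Squnion>A \<odot> y \<sqsubseteq> z \<longleftrightarrow> (\<forall>a\<in>(\<lambda>a. a \<odot> y) ` A. a \<sqsubseteq> z)"
        using 4 z left[of _ y z] by (auto simp: sup_le_iff subset_iff)
    qed (use 4 mult in auto)
  next
    case 5
    have "cyclic G d"
      unfolding cyclic_def
    proof (intro ballI)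
      fix x y assume "x \<in> carrier G" "y \<in> carrier G"
      then show "x \<odot> y \<sqsubseteq> d \<longleftrightarrow> y \<odot> x \<sqsubseteq> d"
        using d(2)[of x y] d(2)[of y x] perp_sym[of x y] by simp
    qed
    moreover have "res_right G x d = n x" "res_left G d x = n x" if x: "x \<in> carrier G" for x
    proof -
      have nx: "n x \<in> carrier G" using perp x by simp
      \<comment> \<open>Both residuals into \<open>d\<close> are suprema of the principal down-set
        of \<open>n x\<close>; dualizing then says that \<open>n\<close> is an involution.\<close>
      have aux: "\<Squnion>A = n x" if "A = {c \<in> carrier G. c \<sqsubseteq> n x}" for A
        unfolding that
        by (rule sup_eqI) (use nx in \<open>auto intro: le_trans\<close>)
      show "res_right G x d = n x" "res_left G d x = n x"
        unfolding res_right_def res_left_def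
        using d(2)[OF _ x] d(2)[OF x] perp_sym[OF x] by (auto intro!: aux)
    qed
    then have "dualizing G d"
      using perp unfolding dualizing_def by simp
    ultimately show ?case using d by blast
  qed
qed

section \<open>Sup-endomorphisms\<close>

context complete_lattice
begin

text \<open>Between complete lattices, preserving suprema amounts to having a right adjoint.\<close>

definition sup_endo :: "('a \<Rightarrow> 'a) set" where
  "sup_endo = {f \<in> carrier L \<rightarrow>\<^sub>E carrier L.
     \<exists>g \<in> carrier L \<rightarrow> carrier L. \<forall>x\<in>carrier L. \<forall>y\<in>carrier L. f x \<sqsubseteq> y \<longleftrightarrow> x \<sqsubseteq> g y}"

definition fun_le :: "('a \<Rightarrow> 'a) \<Rightarrow> ('a \<Rightarrow> 'a) \<Rightarrow> bool" where
  "fun_le f g \<longleftrightarrow> (\<forall>x\<in>carrier L. f x \<sqsubseteq> g x)"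

definition fun_sup :: "('a \<Rightarrow> 'a) set \<Rightarrow> 'a \<Rightarrow> 'a" where
  "fun_sup F = (\<lambda>x\<in>carrier L. \<Squnion>((\<lambda>f. f x) ` F))"

text \<open>The image of the pure tensor \<open>s \<otimes> b\<close> under $S \otimes S^{\mathrm{op}} \to Q$.\<close>

definition rank_one :: "'a \<Rightarrow> 'a \<Rightarrow> 'a \<Rightarrow> 'a" where
  "rank_one b s = (\<lambda>x\<in>carrier L. if x \<sqsubseteq> b then \<bottom> else s)"

lemma sup_endo_closed [simp]: "\<lbrakk>f \<in> sup_endo; x \<in> carrier L\<rbrakk> \<Longrightarrow> f x \<in> carrier L"
  by (auto simp: sup_endo_def)

lemma sup_endo_adjoint:
  assumes "f \<in> sup_endo"
  obtains g where "\<And>y. y \<in> carrier L \<Longrightarrow> g y \<in> carrier L"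
    "\<And>x y. \<lbrakk>x \<in> carrier L; y \<in> carrier L\<rbrakk> \<Longrightarrow> f x \<sqsubseteq> y \<longleftrightarrow> x \<sqsubseteq> g y"
proof -
  obtain g where "g \<in> carrier L \<rightarrow> carrier L"
    "\<forall>x\<in>carrier L. \<forall>y\<in>carrier L. f x \<sqsubseteq> y \<longleftrightarrow> x \<sqsubseteq> g y"
    using assms unfolding sup_endo_def by blast
  then show thesis by (intro that[of g]) auto
qed

lemma sup_endoI:
  assumes "f \<in> extensional (carrier L)"
    and "\<And>x. x \<in> carrier L \<Longrightarrow> f x \<in> carrier L"
    and "\<And>y. y \<in> carrier L \<Longrightarrow> g y \<in> carrier L"
    and "\<And>x y. \<lbrakk>x \<in> carrier L; y \<in> carrier L\<rbrakk> \<Longrightarrow> f x \<sqsubseteq> y \<longleftrightarrow> x \<sqsubseteq> g y"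
  shows "f \<in> sup_endo"
proof -
  have "g \<in> carrier L \<rightarrow> carrier L" using assms(3) by blast
  moreover have "f \<in> carrier L \<rightarrow>\<^sub>E carrier L" using assms(1,2) by (intro PiE_I) (auto simp: extensional_def)
  ultimately show ?thesis using assms(4) unfolding sup_endo_def by blast
qed

lemma sup_endo_mono:
  assumes "f \<in> sup_endo" "x \<in> carrier L" "y \<in> carrier L" "x \<sqsubseteq> y"
  shows "f x \<sqsubseteq> f y"
proof -
  obtain g where g: "\<And>y. y \<in> carrier L \<Longrightarrow> g y \<in> carrier L"
    "\<And>x y. \<lbrakk>x \<in> carrier L; y \<in> carrier L\<rbrakk> \<Longrightarrow> f x \<sqsubseteq> y \<longleftrightarrow> x \<sqsubseteq> g y"
    using sup_endo_adjoint[OF assms(1)] by metis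
  have fy: "f y \<in> carrier L" using assms by simp
  then have "y \<sqsubseteq> g (f y)" using g(2)[of y "f y"] assms by simp
  then have "x \<sqsubseteq> g (f y)"
    using le_trans[OF assms(4)] assms g(1)[OF fy] by simp
  then show ?thesis using g(2)[of x "f y"] fy assms by simp
qed

lemma le_bottomD: "\<lbrakk>x \<sqsubseteq> \<bottom>; x \<in> carrier L\<rbrakk> \<Longrightarrow> x = \<bottom>"
  by (auto intro: le_antisym)

lemma sup_endo_bottom [simp]:
  assumes "f \<in> sup_endo"
  shows "f \<bottom> = \<bottom>"
proof -
  obtain g where g: "\<And>y. y \<in> carrier L \<Longrightarrow> g y \<in> carrier L"
    "\<And>x y. \<lbrakk>x \<in> carrier L; y \<in> carrier L\<rbrakk> \<Longrightarrow> f x \<sqsubseteq> y \<longleftrightarrow> x \<sqsubseteq> g y"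
    using sup_endo_adjoint[OF assms] by metis
  have "f \<bottom> \<sqsubseteq> \<bottom>" using g(2)[of \<bottom> \<bottom>] g(1)[of \<bottom>] by simp
  then show ?thesis using assms by (intro le_bottomD) simp_all
qed

section \<open>Pointwise order and pointwise suprema\<close>

lemma fun_le_refl: "f \<in> sup_endo \<Longrightarrow> fun_le f f"
  by (auto simp: fun_le_def)

lemma fun_le_trans:
  "\<lbrakk>fun_le f g; fun_le g h; f \<in> sup_endo; g \<in> sup_endo; h \<in> sup_endo\<rbrakk> \<Longrightarrow> fun_le f h"
  unfolding fun_le_def by (meson le_trans sup_endo_closed)

text \<open>The order only sees values on the carrier; equality follows because members of
  \<open>sup_endo\<close> are extensional.\<close>

lemma fun_le_antisym:
  assumes "fun_le f g" "fun_le g f" "f \<in> sup_endo" "g \<in> sup_endo"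
  shows "f = g"
proof (rule extensionalityI[where A = "carrier L"])
  show "f \<in> extensional (carrier L)" "g \<in> extensional (carrier L)"
    using assms unfolding sup_endo_def PiE_def by blast+
  show "f x = g x" if "x \<in> carrier L" for x
    using assms that by (auto simp: fun_le_def intro: le_antisym)
qed

lemma fun_sup_le_iff:
  assumes "F \<subseteq> sup_endo" "x \<in> carrier L" "y \<in> carrier L"
  shows "fun_sup F x \<sqsubseteq> y \<longleftrightarrow> (\<forall>f\<in>F. f x \<sqsubseteq> y)"
proof -
  have "(\<lambda>f. f x) ` F \<subseteq> carrier L" using assms by auto
  then show ?thesis using assms by (auto simp: fun_sup_def sup_le_iff)
qed

text \<open>The right adjoint of a pointwise supremum is the pointwise infimum of right adjoints,
  one being chosen for each member of \<open>F\<close>.\<close>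

lemma fun_sup_in_sup_endo:
  assumes F: "F \<subseteq> sup_endo"
  shows "fun_sup F \<in> sup_endo"
proof -
  have "\<forall>f\<in>F. \<exists>g. (\<forall>y\<in>carrier L. g y \<in> carrier L) \<and>
    (\<forall>x\<in>carrier L. \<forall>y\<in>carrier L. f x \<sqsubseteq> y \<longleftrightarrow> x \<sqsubseteq> g y)"
  proof
    fix f assume "f \<in> F"
    with F have "f \<in> sup_endo" by auto
    then obtain g where "\<And>y. y \<in> carrier L \<Longrightarrow> g y \<in> carrier L"
      "\<And>x y. \<lbrakk>x \<in> carrier L; y \<in> carrier L\<rbrakk> \<Longrightarrow> f x \<sqsubseteq> y \<longleftrightarrow> x \<sqsubseteq> g y"
      using sup_endo_adjoint by metis
    then show "\<exists>g. (\<forall>y\<in>carrier L. g y \<in> carrier L) \<and>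
      (\<forall>x\<in>carrier L. \<forall>y\<in>carrier L. f x \<sqsubseteq> y \<longleftrightarrow> x \<sqsubseteq> g y)"
      by (intro exI[of _ g] conjI ballI)
  qed
  from bchoice[OF this] obtain g where "\<forall>f\<in>F. (\<forall>y\<in>carrier L. g f y \<in> carrier L) \<and>
    (\<forall>x\<in>carrier L. \<forall>y\<in>carrier L. f x \<sqsubseteq> y \<longleftrightarrow> x \<sqsubseteq> g f y)" ..
  then have g: "\<And>f y. \<lbrakk>f \<in> F; y \<in> carrier L\<rbrakk> \<Longrightarrow> g f y \<in> carrier L"
    "\<And>f x y. \<lbrakk>f \<in> F; x \<in> carrier L; y \<in> carrier L\<rbrakk> \<Longrightarrow> f x \<sqsubseteq> y \<longleftrightarrow> x \<sqsubseteq> g f y"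
    by simp_all
  show ?thesis
  proof (rule sup_endoI[where g = "\<lambda>y. \<Sqinter>((\<lambda>f. g f y) ` F)"])
    show "fun_sup F \<in> extensional (carrier L)" by (simp add: fun_sup_def)
    show "fun_sup F x \<in> carrier L" if "x \<in> carrier L" for x
      using F that by (auto simp: fun_sup_def intro!: sup_closed)
    fix y assume y: "y \<in> carrier L"
    have sub: "(\<lambda>f. g f y) ` F \<subseteq> carrier L" using g y by auto
    then show "\<Sqinter>((\<lambda>f. g f y) ` F) \<in> carrier L" by simp
    fix x assume x: "x \<in> carrier L"
    have "x \<sqsubseteq> \<Sqinter>((\<lambda>f. g f y) ` F) \<longleftrightarrow> (\<forall>f\<in>F. x \<sqsubseteq> g f y)"
    proof
      assume le: "x \<sqsubseteq> \<Sqinter>((\<lambda>f. g f y) ` F)"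
      show "\<forall>f\<in>F. x \<sqsubseteq> g f y"
      proof
        fix f assume "f \<in> F"
        then show "x \<sqsubseteq> g f y"
          using g x y sub by (intro le_trans[OF le inf_lower[OF sub]]) auto
      qed
    qed (use sub x in \<open>auto intro: inf_greatest\<close>)
    then show "fun_sup F x \<sqsubseteq> y \<longleftrightarrow> x \<sqsubseteq> \<Sqinter>((\<lambda>f. g f y) ` F)"
      using F x y g by (simp add: fun_sup_le_iff)
  qed
qed

lemma fun_sup_upper: "\<lbrakk>F \<subseteq> sup_endo; f \<in> F; x \<in> carrier L\<rbrakk> \<Longrightarrow> f x \<sqsubseteq> fun_sup F x"
  using fun_sup_le_iff[of F x "fun_sup F x"] fun_sup_in_sup_endo[of F] by simp

lemma fun_le_fun_sup: "\<lbrakk>F \<subseteq> sup_endo; f \<in> F\<rbrakk> \<Longrightarrow> fun_le f (fun_sup F)"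
  by (simp add: fun_le_def fun_sup_upper)

lemma fun_sup_least:
  "\<lbrakk>F \<subseteq> sup_endo; g \<in> sup_endo; \<And>f. f \<in> F \<Longrightarrow> fun_le f g\<rbrakk> \<Longrightarrow> fun_le (fun_sup F) g"
  by (auto simp: fun_le_def fun_sup_le_iff)

section \<open>Rank-one maps, the identity and composites\<close>

lemma rank_one_apply: "x \<in> carrier L \<Longrightarrow> rank_one b s x = (if x \<sqsubseteq> b then \<bottom> else s)"
  by (simp add: rank_one_def)

text \<open>\<open>rank_one b s x \<sqsubseteq> y\<close> means \<open>x \<sqsubseteq> b\<close> or
  \<open>s \<sqsubseteq> y\<close>, whence the two-valued right adjoint.\<close>

lemma rank_one_in_sup_endo [simp]:
  assumes "b \<in> carrier L" "s \<in> carrier L"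
  shows "rank_one b s \<in> sup_endo"
proof (rule sup_endoI[where g = "\<lambda>y. if s \<sqsubseteq> y then \<top> else b"])
  show "rank_one b s \<in> extensional (carrier L)" by (simp add: rank_one_def)
qed (use assms in \<open>auto simp: rank_one_apply\<close>)

lemma id_in_sup_endo [simp]: "(\<lambda>x\<in>carrier L. x) \<in> sup_endo"
  by (rule sup_endoI[where g = "\<lambda>x. x"]) auto

lemma compose_in_sup_endo [simp]:
  assumes "f \<in> sup_endo" "g \<in> sup_endo"
  shows "compose (carrier L) f g \<in> sup_endo"
proof -
  obtain f' where f': "\<And>y. y \<in> carrier L \<Longrightarrow> f' y \<in> carrier L"
    "\<And>x y. \<lbrakk>x \<in> carrier L; y \<in> carrier L\<rbrakk> \<Longrightarrow> f x \<sqsubseteq> y \<longleftrightarrow> x \<sqsubseteq> f' y"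
    using sup_endo_adjoint[OF assms(1)] by metis
  obtain g' where g': "\<And>y. y \<in> carrier L \<Longrightarrow> g' y \<in> carrier L"
    "\<And>x y. \<lbrakk>x \<in> carrier L; y \<in> carrier L\<rbrakk> \<Longrightarrow> g x \<sqsubseteq> y \<longleftrightarrow> x \<sqsubseteq> g' y"
    using sup_endo_adjoint[OF assms(2)] by metis
  show ?thesis
    by (rule sup_endoI[where g = "\<lambda>y. g' (f' y)"])
      (use assms f' g' in \<open>auto simp: compose_def\<close>)
qed

section \<open>The Girard quantale\<close>

text \<open>For sup-endomorphisms this says that every \<open>rank_one (q s) s\<close> lies below
  \<open>p\<close>. It is symmetric in \<open>q\<close> and \<open>p\<close>, so the swap preserves
  it.\<close>

definition linked :: "('a \<Rightarrow> 'a) \<Rightarrow> ('a \<Rightarrow> 'a) \<Rightarrow> bool" where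
  "linked q p \<longleftrightarrow> (\<forall>x\<in>carrier L. \<forall>s\<in>carrier L. s \<sqsubseteq> p x \<or> x \<sqsubseteq> q s)"

text \<open>The second map is stored as its graph, to fit the prescribed type.\<close>

definition gpair :: "('a \<Rightarrow> 'a) \<Rightarrow> ('a \<Rightarrow> 'a) \<Rightarrow> 'a girard_elem" where
  "gpair q p = (q, {(x, p x) | x. True})"

definition gfst :: "'a girard_elem \<Rightarrow> 'a \<Rightarrow> 'a" where
  "gfst = fst"

text \<open>The graph in \<open>gpair\<close> ranges over the whole type, so \<open>p\<close> is
  recovered outside the carrier too.\<close>

definition gsnd :: "'a girard_elem \<Rightarrow> 'a \<Rightarrow> 'a" where
  "gsnd g x = (THE y. (x, y) \<in> snd g)"

definition gcarrier :: "'a girard_elem set" where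
  "gcarrier = {gpair q p | q p. q \<in> sup_endo \<and> p \<in> sup_endo \<and> linked q p}"

definition gperp :: "'a girard_elem \<Rightarrow> 'a girard_elem" where
  "gperp g = gpair (gsnd g) (gfst g)"

text \<open>With \<open>r = gfst k\<close> these are the two inequalities for
  \<open>g h \<le> k^perp\<close> that do not concern \<open>gsnd k\<close>. The largest such
  \<open>r\<close>, a meet of two residuals, becomes the second component of the product.\<close>

definition mult_bounds :: "'a girard_elem \<Rightarrow> 'a girard_elem \<Rightarrow> ('a \<Rightarrow> 'a) set" where
  "mult_bounds g h = {r \<in> sup_endo.
     fun_le (compose (carrier L) r (gfst g)) (gsnd h) \<and>
     fun_le (compose (carrier L) (gfst h) r) (gsnd g)}"

definition gmult :: "'a girard_elem \<Rightarrow> 'a girard_elem \<Rightarrow> 'a girard_elem" where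
  "gmult g h = gpair (compose (carrier L) (gfst g) (gfst h)) (fun_sup (mult_bounds g h))"

definition girard :: "'a girard_elem quantale" where
  "girard = \<lparr> carrier = gcarrier, eq = (=),
     le = (\<lambda>g h. fun_le (gfst g) (gfst h) \<and> fun_le (gsnd h) (gsnd g)), qmult = gmult \<rparr>"

lemma gfst_gpair [simp]: "gfst (gpair q p) = q"
  by (simp add: gfst_def gpair_def)

lemma gsnd_gpair [simp]: "gsnd (gpair q p) = p"
  by (rule ext) (simp add: gsnd_def gpair_def)

lemma gpair_in_gcarrier:
  "\<lbrakk>q \<in> sup_endo; p \<in> sup_endo; linked q p\<rbrakk> \<Longrightarrow> gpair q p \<in> gcarrier"
  by (auto simp: gcarrier_def)

lemma gcarrierD [simp]:
  assumes "g \<in> gcarrier"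
  shows "gfst g \<in> sup_endo" "gsnd g \<in> sup_endo" "gpair (gfst g) (gsnd g) = g"
  using assms by (auto simp: gcarrier_def)

lemma gcarrier_linked:
  assumes "g \<in> gcarrier" "x \<in> carrier L" "s \<in> carrier L" "\<not> x \<sqsubseteq> gfst g s"
  shows "s \<sqsubseteq> gsnd g x"
proof -
  have "linked (gfst g) (gsnd g)"
    using assms(1) by (auto simp: gcarrier_def)
  then show ?thesis
    using assms(2-4) unfolding linked_def by blast
qed

lemma gcarrier_eqI:
  "\<lbrakk>g \<in> gcarrier; h \<in> gcarrier; gfst g = gfst h; gsnd g = gsnd h\<rbrakk> \<Longrightarrow> g = h"
  by (metis gcarrierD(3))

lemma gperp_closed:
  assumes "g \<in> gcarrier"
  shows "gperp g \<in> gcarrier"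
  unfolding gperp_def
proof (rule gpair_in_gcarrier)
  show "linked (gsnd g) (gfst g)"
    unfolding linked_def using gcarrier_linked[OF assms] by blast
qed (use assms in simp_all)

text \<open>Rank-one maps suffice to link \<open>q\<close> to a supremum of sup-endomorphisms.\<close>

lemma linked_fun_sup:
  assumes "q \<in> sup_endo" "F \<subseteq> sup_endo"
    and "\<And>s. s \<in> carrier L \<Longrightarrow> rank_one (q s) s \<in> F"
  shows "linked q (fun_sup F)"
  unfolding linked_def
proof (intro ballI)
  fix x s assume "x \<in> carrier L" "s \<in> carrier L"
  with fun_sup_upper[OF assms(2) assms(3)[of s], of x] show "s \<sqsubseteq> fun_sup F x \<or> x \<sqsubseteq> q s"
    by (auto simp: rank_one_apply split: if_splits)
qed

lemma mult_bounds_subset: "mult_bounds g h \<subseteq> sup_endo"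
  by (auto simp: mult_bounds_def)

text \<open>By \<open>linked_fun_sup\<close> it is enough that the rank-one maps attached to the
  composite \<open>?q\<close> are among the bounds.\<close>

lemma gmult_closed:
  assumes g: "g \<in> gcarrier" and h: "h \<in> gcarrier"
  shows "gmult g h \<in> gcarrier"
  unfolding gmult_def
proof (intro gpair_in_gcarrier linked_fun_sup mult_bounds_subset fun_sup_in_sup_endo)
  let ?q = "compose (carrier L) (gfst g) (gfst h)"
  \<comment> \<open>Required both for the carrier and for \<open>linked_fun_sup\<close>.\<close>
  show q: "?q \<in> sup_endo" "?q \<in> sup_endo" using g h by auto
  fix s assume s: "s \<in> carrier L"
  have qs: "?q s = gfst g (gfst h s)" using s by (simp add: compose_def)
  have qs': "gfst g (gfst h s) \<in> carrier L" "gfst h s \<in> carrier L" using g h s by auto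
  \<comment> \<open>If the left side is not bottom, monotonicity of \<open>gfst g\<close> excludes
    \<open>t \<sqsubseteq> gfst h s\<close>, and the link of \<open>h\<close> gives
    \<open>s \<sqsubseteq> gsnd h t\<close>.\<close>
  have "rank_one (?q s) s (gfst g t) \<sqsubseteq> gsnd h t" if t: "t \<in> carrier L" for t
    using gcarrier_linked[OF h t s] sup_endo_mono[of "gfst g" t "gfst h s"] g h s t qs'
    by (auto simp: rank_one_apply qs)
  \<comment> \<open>Here the link of \<open>g\<close> is applied at the element
    \<open>gfst h s\<close>.\<close>
  moreover have "gfst h (rank_one (?q s) s t) \<sqsubseteq> gsnd g t" if t: "t \<in> carrier L" for t
    using gcarrier_linked[OF g t qs'(2)] g h s t by (auto simp: rank_one_apply qs)
  moreover have "rank_one (?q s) s \<in> sup_endo"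
    by (rule rank_one_in_sup_endo[OF sup_endo_closed[OF q(1) s] s])
  ultimately show "rank_one (?q s) s \<in> mult_bounds g h"
    using g h s by (simp add: mult_bounds_def fun_le_def compose_eq)
qed

section \<open>Order, duality and the cyclic form of the multiplication\<close>

lemma girard_simps [simp]:
  "carrier girard = gcarrier"
  "g \<sqsubseteq>\<^bsub>girard\<^esub> h \<longleftrightarrow> fun_le (gfst g) (gfst h) \<and> fun_le (gsnd h) (gsnd g)"
  "g \<odot>\<^bsub>girard\<^esub> h = gmult g h"
  "(.=\<^bsub>girard\<^esub>) = (=)"
  by (simp_all add: girard_def)

lemma gperp_simps [simp]:
  "gfst (gperp g) = gsnd g" "gsnd (gperp g) = gfst g"
  by (simp_all add: gperp_def)

lemma gperp_gperp: "g \<in> gcarrier \<Longrightarrow> gperp (gperp g) = g"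
  by (simp add: gcarrier_eqI gperp_closed)

text \<open>The supremum of the bounds is itself a bound, since composing with a sup-endomorphism on
  either side preserves pointwise suprema.\<close>

lemma fun_le_gsnd_gmult_iff:
  assumes g: "g \<in> gcarrier" and h: "h \<in> gcarrier" and r: "r \<in> sup_endo"
  shows "fun_le r (gsnd (gmult g h)) \<longleftrightarrow>
    (\<forall>x\<in>carrier L. r (gfst g x) \<sqsubseteq> gsnd h x \<and> gfst h (r x) \<sqsubseteq> gsnd g x)"
proof
  let ?m = "fun_sup (mult_bounds g h)"
  have m: "?m \<in> sup_endo" by (simp add: fun_sup_in_sup_endo mult_bounds_subset)
  assume "fun_le r (gsnd (gmult g h))"
  then have le: "r x \<sqsubseteq> ?m x" if "x \<in> carrier L" for x
    using that by (simp add: gmult_def fun_le_def)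
  have "?m (gfst g x) \<sqsubseteq> gsnd h x" if x: "x \<in> carrier L" for x
    using g h x by (auto simp: fun_sup_le_iff mult_bounds_subset)
      (auto simp: mult_bounds_def fun_le_def compose_def)
  then have "r (gfst g x) \<sqsubseteq> gsnd h x" if x: "x \<in> carrier L" for x
    using le x g h r m by (meson le_trans sup_endo_closed gcarrierD)
  \<comment> \<open>The right adjoint moves \<open>gfst h\<close> past the supremum.\<close>
  moreover obtain h' where h': "\<And>y. y \<in> carrier L \<Longrightarrow> h' y \<in> carrier L"
    "\<And>x y. \<lbrakk>x \<in> carrier L; y \<in> carrier L\<rbrakk> \<Longrightarrow> gfst h x \<sqsubseteq> y \<longleftrightarrow> x \<sqsubseteq> h' y"
    using sup_endo_adjoint[of "gfst h"] h by auto
  have "gfst h (?m x) \<sqsubseteq> gsnd g x" if x: "x \<in> carrier L" for x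
  proof -
    have "f x \<sqsubseteq> h' (gsnd g x)" if f: "f \<in> mult_bounds g h" for f
    proof -
      have "f \<in> sup_endo" "gfst h (f x) \<sqsubseteq> gsnd g x"
        using f x by (auto simp: mult_bounds_def fun_le_def compose_def)
      then show ?thesis using h'(2)[of "f x" "gsnd g x"] x g by simp
    qed
    then have "?m x \<sqsubseteq> h' (gsnd g x)"
      using x g h' by (simp add: fun_sup_le_iff mult_bounds_subset)
    then show ?thesis using h'(2)[of "?m x" "gsnd g x"] x g m by simp
  qed
  then have "gfst h (r x) \<sqsubseteq> gsnd g x" if x: "x \<in> carrier L" for x
    using le x g h r m
    by (intro le_trans[OF sup_endo_mono[of "gfst h" "r x" "?m x"]]) auto
  ultimately show "\<forall>x\<in>carrier L. r (gfst g x) \<sqsubseteq> gsnd h x \<and> gfst h (r x) \<sqsubseteq> gsnd g x"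
    by blast
next
  assume "\<forall>x\<in>carrier L. r (gfst g x) \<sqsubseteq> gsnd h x \<and> gfst h (r x) \<sqsubseteq> gsnd g x"
  then have "r \<in> mult_bounds g h"
    using r by (auto simp: mult_bounds_def fun_le_def compose_def)
  then show "fun_le r (gsnd (gmult g h))"
    by (simp add: gmult_def fun_le_fun_sup mult_bounds_subset)
qed

lemma gfst_gmult: "x \<in> carrier L \<Longrightarrow> gfst (gmult g h) x = gfst g (gfst h x)"
  by (simp add: gmult_def compose_def)

text \<open>The first inequality compares first components; the other two are the preceding
  equivalence for \<open>r = gfst k\<close>.\<close>

lemma gmult_le_iff:
  assumes "g \<in> gcarrier" "h \<in> gcarrier" "k \<in> gcarrier"
  shows "gmult g h \<sqsubseteq>\<^bsub>girard\<^esub> gperp k \<longleftrightarrow>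
    (\<forall>x\<in>carrier L. gfst g (gfst h x) \<sqsubseteq> gsnd k x \<and> gfst h (gfst k x) \<sqsubseteq> gsnd g x
       \<and> gfst k (gfst g x) \<sqsubseteq> gsnd h x)"
  using assms by (auto simp: fun_le_gsnd_gmult_iff) (auto simp: fun_le_def gfst_gmult)

lemma gmult_cyclic:
  "\<lbrakk>g \<in> gcarrier; h \<in> gcarrier; k \<in> gcarrier\<rbrakk> \<Longrightarrow>
    gmult g h \<sqsubseteq>\<^bsub>girard\<^esub> gperp k \<longleftrightarrow> gmult h k \<sqsubseteq>\<^bsub>girard\<^esub> gperp g"
  by (auto simp: gmult_le_iff simp del: girard_simps(2))

section \<open>Completeness, associativity and the dualizing element\<close>

lemma girard_partial_order: "partial_order girard"
proof (unfold_locales, goal_cases)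
  case (5 x y)
  then show ?case by (auto intro!: gcarrier_eqI fun_le_antisym)
next
  case (6 x y z)
  then show ?case by (auto intro: fun_le_trans)
qed (auto intro: fun_le_refl)

lemma girard_complete_lattice: "complete_lattice girard"
proof (rule partial_order.complete_lattice_supI[OF girard_partial_order])
  fix A assume "A \<subseteq> carrier girard"
  then have A: "A \<subseteq> gcarrier" by simp
  define Q where "Q = gfst ` A"
  \<comment> \<open>The reversed second component needs an infimum in \<open>sup_endo\<close>. A
    pointwise infimum need not preserve suprema, so the supremum of all lower bounds is
    taken.\<close>
  define P where "P = {r \<in> sup_endo. \<forall>g\<in>A. fun_le r (gsnd g)}"
  have Q: "Q \<subseteq> sup_endo" and P: "P \<subseteq> sup_endo" using A by (auto simp: Q_def P_def)
  have "linked (fun_sup Q) (fun_sup P)"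
  proof (rule linked_fun_sup)
    fix s assume s: "s \<in> carrier L"
    \<comment> \<open>If \<open>t\<close> is not below \<open>fun_sup Q s\<close>, it is not below
      \<open>gfst g s\<close> either, and the link of \<open>g\<close> applies.\<close>
    have "rank_one (fun_sup Q s) s t \<sqsubseteq> gsnd g t" if g: "g \<in> A" and t: "t \<in> carrier L" for g t
    proof -
      have gc: "g \<in> gcarrier" using A g by auto
      have "gfst g s \<sqsubseteq> fun_sup Q s" using Q g s by (auto simp: Q_def intro: fun_sup_upper)
      moreover have "fun_sup Q s \<in> carrier L" using fun_sup_in_sup_endo[OF Q] s by simp
      ultimately show ?thesis
        using gcarrier_linked[OF gc t s] gc s t le_trans[of t "gfst g s" "fun_sup Q s"]
        by (auto simp: rank_one_apply)
    qed
    then show "rank_one (fun_sup Q s) s \<in> P"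
      using s fun_sup_in_sup_endo[OF Q] by (auto simp: P_def fun_le_def)
  qed (use Q P in \<open>auto intro: fun_sup_in_sup_endo\<close>)
  then have s: "gpair (fun_sup Q) (fun_sup P) \<in> gcarrier" (is "?s \<in> _")
    using Q P by (intro gpair_in_gcarrier fun_sup_in_sup_endo)
  have "g \<sqsubseteq>\<^bsub>girard\<^esub> ?s" if g: "g \<in> A" for g
  proof -
    have "fun_le (fun_sup P) (gsnd g)"
      using A P g by (intro fun_sup_least) (auto simp: P_def)
    then show ?thesis using Q g by (auto simp: Q_def intro: fun_le_fun_sup)
  qed
  moreover have "?s \<sqsubseteq>\<^bsub>girard\<^esub> z" if z: "z \<in> gcarrier" "\<forall>g\<in>A. g \<sqsubseteq>\<^bsub>girard\<^esub> z" for z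
  proof -
    have "fun_le (gsnd z) (fun_sup P)"
      using P z by (intro fun_le_fun_sup) (auto simp: P_def)
    moreover have "fun_le (fun_sup Q) (gfst z)"
      using Q z by (intro fun_sup_least) (auto simp: Q_def)
    ultimately show ?thesis by simp
  qed
  ultimately show "\<exists>s\<in>carrier girard. (\<forall>a\<in>A. a \<sqsubseteq>\<^bsub>girard\<^esub> s) \<and>
      (\<forall>z\<in>carrier girard. (\<forall>a\<in>A. a \<sqsubseteq>\<^bsub>girard\<^esub> z) \<longrightarrow> s \<sqsubseteq>\<^bsub>girard\<^esub> z)"
    using s by (intro bexI[of _ ?s]) (simp_all del: girard_simps(2))
qed

text \<open>Every element is some \<open>gperp k\<close>, so this compares upper bounds; it allows
  identities to be tested through \<open>gmult_le_iff\<close>.\<close>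

lemma girard_eqI:
  assumes g: "g \<in> gcarrier" and h: "h \<in> gcarrier"
    and le: "\<And>k. k \<in> gcarrier \<Longrightarrow> g \<sqsubseteq>\<^bsub>girard\<^esub> gperp k \<longleftrightarrow> h \<sqsubseteq>\<^bsub>girard\<^esub> gperp k"
  shows "g = h"
proof -
  interpret G: partial_order girard by (rule girard_partial_order)
  have "g \<sqsubseteq>\<^bsub>girard\<^esub> h" "h \<sqsubseteq>\<^bsub>girard\<^esub> g"
    using le[OF gperp_closed[OF g]] le[OF gperp_closed[OF h]] g h G.le_refl
    by (simp_all add: gperp_gperp fun_le_refl)
  then show ?thesis using G.le_antisym g h girard_simps(1) by blast
qed

text \<open>One inequality of \<open>gmult_le_iff\<close> bounds the composite of
  \<open>gfst k\<close> and \<open>gfst l\<close> by \<open>gsnd (gmult g h)\<close>; unfolding it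
  splits it in two and gives a condition invariant under cyclic permutation of the four
  elements.\<close>

lemma gmult_triple_le_iff:
  assumes "g \<in> gcarrier" "h \<in> gcarrier" "k \<in> gcarrier" "l \<in> gcarrier"
  shows "gmult (gmult g h) k \<sqsubseteq>\<^bsub>girard\<^esub> gperp l \<longleftrightarrow>
    (\<forall>x\<in>carrier L. gfst g (gfst h (gfst k x)) \<sqsubseteq> gsnd l x \<and> gfst h (gfst k (gfst l x)) \<sqsubseteq> gsnd g x
      \<and> gfst k (gfst l (gfst g x)) \<sqsubseteq> gsnd h x \<and> gfst l (gfst g (gfst h x)) \<sqsubseteq> gsnd k x)"
proof -
  have "(\<forall>x\<in>carrier L. gfst k (gfst l x) \<sqsubseteq> gsnd (gmult g h) x) \<longleftrightarrow>
    fun_le (compose (carrier L) (gfst k) (gfst l)) (gsnd (gmult g h))"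
    by (simp add: fun_le_def compose_def)
  also have "\<dots> \<longleftrightarrow> (\<forall>x\<in>carrier L. gfst k (gfst l (gfst g x)) \<sqsubseteq> gsnd h x \<and>
    gfst h (gfst k (gfst l x)) \<sqsubseteq> gsnd g x)"
    using assms fun_le_gsnd_gmult_iff[of g h "compose (carrier L) (gfst k) (gfst l)"]
    by (simp add: compose_eq)
  finally show ?thesis
    using assms
    by (auto simp: gmult_le_iff gmult_closed gfst_gmult ball_conj_distrib
        simp del: girard_simps(2))
qed

text \<open>A rotation turns the right-hand bracketing into a left-hand one, with the same four
  inequalities.\<close>

lemma gmult_assoc:
  assumes "g \<in> gcarrier" "h \<in> gcarrier" "k \<in> gcarrier"
  shows "gmult (gmult g h) k = gmult g (gmult h k)"
proof (rule girard_eqI)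
  fix l assume l: "l \<in> gcarrier"
  have "gmult g (gmult h k) \<sqsubseteq>\<^bsub>girard\<^esub> gperp l \<longleftrightarrow> gmult (gmult h k) l \<sqsubseteq>\<^bsub>girard\<^esub> gperp g"
    using assms l by (intro gmult_cyclic gmult_closed)
  then show "gmult (gmult g h) k \<sqsubseteq>\<^bsub>girard\<^esub> gperp l \<longleftrightarrow>
      gmult g (gmult h k) \<sqsubseteq>\<^bsub>girard\<^esub> gperp l"
    using assms l by (auto simp: gmult_triple_le_iff simp del: girard_simps(2))
qed (use assms in \<open>auto intro: gmult_closed\<close>)

lemma girard_girard_quantale: "girard_quantale girard"
proof (rule girard_quantaleI[where n = gperp
      \<comment> \<open>The dualizing element is the swap of the multiplicative unit, which pairs
        the identity with the greatest sup-endomorphism.\<close>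
      and d = "gpair (rank_one \<bottom> \<top>) (\<lambda>x\<in>carrier L. x)"], goal_cases)
  case 1
  show ?case by (rule girard_complete_lattice)
next
  case (7 x y z)
  then show ?case
    using gmult_cyclic by simp
next
  case 8
  show ?case
    by (auto intro!: gpair_in_gcarrier simp: linked_def rank_one_apply dest!: le_bottomD)
next
  case (9 x y)
  \<comment> \<open>The first component imposes nothing; the second, with \<open>r\<close> the
    identity, says exactly \<open>x \<le> gperp y\<close>.\<close>
  then have "fun_le (gfst (gmult x y)) (rank_one \<bottom> \<top>)"
    using gmult_closed[of x y]
    by (auto simp: fun_le_def rank_one_apply dest!: le_bottomD)
  with 9 show ?case
    by (auto simp: fun_le_gsnd_gmult_iff) (auto simp: fun_le_def)
qed (auto simp: gperp_closed gperp_gperp gmult_closed gmult_assoc)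

section \<open>One-sided elements\<close>

lemma girard_top: "\<top>\<^bsub>girard\<^esub> = gpair (rank_one \<bottom> \<top>) (rank_one \<bottom> \<bottom>)" (is "_ = ?t")
  and gtop_closed: "gpair (rank_one \<bottom> \<top>) (rank_one \<bottom> \<bottom>) \<in> gcarrier"
proof -
  interpret G: complete_lattice girard by (rule girard_complete_lattice)
  show t: "?t \<in> gcarrier"
    by (auto intro!: gpair_in_gcarrier simp: linked_def rank_one_apply dest!: le_bottomD)
  have "g \<sqsubseteq>\<^bsub>girard\<^esub> ?t" if "g \<in> gcarrier" for g
    using that by (auto simp: fun_le_def rank_one_apply dest!: le_bottomD)
  then show "\<top>\<^bsub>girard\<^esub> = ?t"
    using t G.top_closed G.top_higher
    by (intro G.le_antisym) (simp_all del: girard_simps(2))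
qed

definition right_elem :: "'a \<Rightarrow> 'a girard_elem" where
  "right_elem a = gpair (rank_one \<bottom> a) (rank_one a \<top>)"

lemma right_elem_closed: "a \<in> carrier L \<Longrightarrow> right_elem a \<in> gcarrier"
  unfolding right_elem_def
  by (auto intro!: gpair_in_gcarrier simp: linked_def rank_one_apply dest!: le_bottomD)

lemma gfst_right_elem_top: "a \<in> carrier L \<Longrightarrow> gfst (right_elem a) \<top> = a"
  \<comment> \<open>In the one-element lattice top is bottom and \<open>rank_one\<close> returns
    bottom, which is then \<open>a\<close>.\<close>
  using le_trans[of a \<top> \<bottom>] by (auto simp: right_elem_def rank_one_apply dest!: le_bottomD)

lemma right_elem_le_iff:
  assumes "a \<in> carrier L" "b \<in> carrier L"
  shows "right_elem a \<sqsubseteq>\<^bsub>girard\<^esub> right_elem b \<longleftrightarrow> a \<sqsubseteq> b"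
proof
  assume "right_elem a \<sqsubseteq>\<^bsub>girard\<^esub> right_elem b"
  then show "a \<sqsubseteq> b"
    using assms gfst_right_elem_top by (auto simp: fun_le_def dest: bspec[of _ _ \<top>])
next
  assume "a \<sqsubseteq> b"
  then show "right_elem a \<sqsubseteq>\<^bsub>girard\<^esub> right_elem b"
    using assms by (auto simp: fun_le_def right_elem_def rank_one_apply intro: le_trans)
qed

lemma gmult_top_le_iff:
  assumes g: "g \<in> gcarrier"
  shows "gmult g \<top>\<^bsub>girard\<^esub> \<sqsubseteq>\<^bsub>girard\<^esub> g \<longleftrightarrow> (\<exists>a\<in>carrier L. g = right_elem a)"
proof -
  let ?q = "gfst g" and ?p = "gsnd g"
  \<comment> \<open>The second line is \<open>fun_le_gsnd_gmult_iff\<close> for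
    \<open>r = gsnd g\<close>.\<close>
  have iff: "gmult g \<top>\<^bsub>girard\<^esub> \<sqsubseteq>\<^bsub>girard\<^esub> g \<longleftrightarrow>
    (\<forall>x\<in>carrier L. ?q (rank_one \<bottom> \<top> x) \<sqsubseteq> ?q x) \<and>
    (\<forall>x\<in>carrier L. ?p (?q x) \<sqsubseteq> rank_one \<bottom> \<bottom> x \<and> rank_one \<bottom> \<top> (?p x) \<sqsubseteq> ?p x)"
    using g gtop_closed
    by (simp add: girard_top fun_le_gsnd_gmult_iff) (simp add: fun_le_def gfst_gmult)
  show ?thesis
  proof
    assume "gmult g \<top>\<^bsub>girard\<^esub> \<sqsubseteq>\<^bsub>girard\<^esub> g"
    then have q: "x \<sqsubseteq> \<bottom> \<or> ?q \<top> \<sqsubseteq> ?q x" and pq: "?p (?q x) \<sqsubseteq> \<bottom>"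
      if "x \<in> carrier L" for x
      using that unfolding iff by (auto simp: rank_one_apply split: if_splits)
    have qtop: "?q \<top> \<in> carrier L" using g by simp
    have "g = right_elem (?q \<top>)"
    proof (rule gcarrier_eqI)
      have "fun_le (rank_one \<bottom> (?q \<top>)) ?q" "fun_le ?q (rank_one \<bottom> (?q \<top>))"
        using q g by (auto simp: fun_le_def rank_one_apply intro: sup_endo_mono dest!: le_bottomD)
      then show "?q = gfst (right_elem (?q \<top>))"
        using g qtop by (auto simp: right_elem_def intro: fun_le_antisym)
      \<comment> \<open>Below \<open>?q \<top>\<close> the map \<open>?p\<close> vanishes by
        monotonicity; elsewhere the link at \<open>s = \<top>\<close> forces the value top.\<close>
      have "?p x \<sqsubseteq> \<bottom>" if "x \<in> carrier L" "x \<sqsubseteq> ?q \<top>" for x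
        using that g qtop pq[of \<top>] sup_endo_mono[of ?p x "?q \<top>"]
          le_trans[of "?p x" "?p (?q \<top>)" \<bottom>] by simp
      then have "fun_le (rank_one (?q \<top>) \<top>) ?p" "fun_le ?p (rank_one (?q \<top>) \<top>)"
        using g gcarrier_linked[OF g, of _ \<top>] by (auto simp: fun_le_def rank_one_apply)
      then show "?p = gsnd (right_elem (?q \<top>))"
        using g qtop by (auto simp: right_elem_def intro: fun_le_antisym)
    qed (use g qtop right_elem_closed in auto)
    with qtop show "\<exists>a\<in>carrier L. g = right_elem a" by blast
  next
    assume "\<exists>a\<in>carrier L. g = right_elem a"
    then show "gmult g \<top>\<^bsub>girard\<^esub> \<sqsubseteq>\<^bsub>girard\<^esub> g"
      unfolding iff by (auto simp: right_elem_def rank_one_apply dest: le_bottomD)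
  qed
qed

text \<open>Writing \<open>g\<close> as a double dual and rotating turns left-sidedness of
  \<open>g\<close> into right-sidedness of \<open>gperp g\<close>.\<close>

lemma top_gmult_le_iff:
  assumes g: "g \<in> gcarrier"
  shows "gmult \<top>\<^bsub>girard\<^esub> g \<sqsubseteq>\<^bsub>girard\<^esub> g \<longleftrightarrow> (\<exists>a\<in>carrier L. g = gperp (right_elem a))"
proof -
  have t: "\<top>\<^bsub>girard\<^esub> \<in> gcarrier" using gtop_closed by (simp add: girard_top)
  have "gmult \<top>\<^bsub>girard\<^esub> g \<sqsubseteq>\<^bsub>girard\<^esub> g \<longleftrightarrow>
      gmult (gperp g) \<top>\<^bsub>girard\<^esub> \<sqsubseteq>\<^bsub>girard\<^esub> gperp g"
    using gmult_cyclic[OF gperp_closed[OF g] t g] gperp_gperp[OF g] by simp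
  also have "\<dots> \<longleftrightarrow> (\<exists>a\<in>carrier L. gperp g = right_elem a)"
    by (rule gmult_top_le_iff[OF gperp_closed[OF g]])
  also have "\<dots> \<longleftrightarrow> (\<exists>a\<in>carrier L. g = gperp (right_elem a))"
    using g gperp_gperp right_elem_closed by metis
  finally show ?thesis .
qed

section \<open>The two isomorphisms\<close>

lemma right_sided_girard_iso: "sup_lattice_iso (right_sided girard) L"
\<comment> \<open>Evaluation at top recovers \<open>a\<close> from
  \<open>right_elem a\<close>.\<close>
proof (rule sup_lattice_isoI[where h = "\<lambda>g. gfst g \<top>"])
  have R: "carrier (right_sided girard) = right_elem ` carrier L"
  proof (rule Set.set_eqI)
    fix g
    have "g \<in> carrier (right_sided girard) \<longleftrightarrow>
        g \<in> gcarrier \<and> (\<exists>a\<in>carrier L. g = right_elem a)"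
      using gmult_top_le_iff[of g] by (auto simp: right_sided_def simp del: girard_simps(2))
    then show "g \<in> carrier (right_sided girard) \<longleftrightarrow> g \<in> right_elem ` carrier L"
      using right_elem_closed by blast
  qed
  show "bij_betw (\<lambda>g. gfst g \<top>) (carrier (right_sided girard)) (carrier L)"
    unfolding R by (rule bij_betw_byWitness[where f' = right_elem])
      (auto simp: gfst_right_elem_top)
  show "x \<sqsubseteq>\<^bsub>right_sided girard\<^esub> y \<longleftrightarrow> gfst x \<top> \<sqsubseteq> gfst y \<top>"
    if "x \<in> carrier (right_sided girard)" "y \<in> carrier (right_sided girard)" for x y
    using that right_elem_le_iff unfolding R
    by (auto simp: right_sided_def gfst_right_elem_top simp del: girard_simps(2))
qed (auto simp: right_sided_def complete_lattice_axioms)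

lemma left_sided_girard_iso: "sup_lattice_iso (left_sided girard) (inv_gorder L)"
\<comment> \<open>The swap moves the map carrying \<open>a\<close> into the second component, where
  the order is reversed.\<close>
proof (rule sup_lattice_isoI[where h = "\<lambda>g. gsnd g \<top>"])
  have R: "carrier (left_sided girard) = (\<lambda>a. gperp (right_elem a)) ` carrier L"
  proof (rule Set.set_eqI)
    fix g
    have "g \<in> carrier (left_sided girard) \<longleftrightarrow>
        g \<in> gcarrier \<and> (\<exists>a\<in>carrier L. g = gperp (right_elem a))"
      using top_gmult_le_iff[of g] by (auto simp: left_sided_def simp del: girard_simps(2))
    then show "g \<in> carrier (left_sided girard) \<longleftrightarrow>
        g \<in> (\<lambda>a. gperp (right_elem a)) ` carrier L"
      using right_elem_closed gperp_closed by blast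
  qed
  show "bij_betw (\<lambda>g. gsnd g \<top>) (carrier (left_sided girard)) (carrier (inv_gorder L))"
    unfolding R by (rule bij_betw_byWitness[where f' = "\<lambda>a. gperp (right_elem a)"])
      (auto simp: gfst_right_elem_top)
  show "x \<sqsubseteq>\<^bsub>left_sided girard\<^esub> y \<longleftrightarrow> gsnd x \<top> \<sqsubseteq>\<^bsub>inv_gorder L\<^esub> gsnd y \<top>"
    if "x \<in> carrier (left_sided girard)" "y \<in> carrier (left_sided girard)" for x y
  proof -
    obtain a where "a \<in> carrier L" "x = gperp (right_elem a)"
      using \<open>x \<in> _\<close> unfolding R by (rule imageE)
    moreover obtain b where "b \<in> carrier L" "y = gperp (right_elem b)"
      using \<open>y \<in> _\<close> unfolding R by (rule imageE)
    ultimately show ?thesis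
      using right_elem_le_iff[of b a] by (auto simp: left_sided_def gfst_right_elem_top)
  qed
qed (auto simp: left_sided_def dual_complete_lattice)

end

theorem corollary3p16:
  fixes S :: "'a gorder"
  assumes "complete_lattice S"
  shows "\<exists>G :: 'a girard_elem quantale.
           girard_quantale G
         \<and> sup_lattice_iso (right_sided G) S
         \<and> sup_lattice_iso (left_sided G) (inv_gorder S)"
proof -
  interpret complete_lattice S by fact
  show ?thesis
    using girard_girard_quantale right_sided_girard_iso left_sided_girard_iso by blast
qed

end
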